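(* Let $n\ge 2$ and $p$ be positive integers and let $t$ be an $\alpha$-almost supermagic edge labeling of $K_n$. Then $$(2n-4)p+\alpha\ \ge\ R(p,t,n)\ \ge\ (n-2p-19)p-\alpha.$$
   Context: $K_n$ is the complete graph on $n$ vertices with edge set $E$, $\epsilon=\binom n2$, $[a]=\{1,\dots,a\}$. For a vertex $v$, $D(v)$ is the set of edges containing $v$. An edge labeling is a bijection $t:E\to[\epsilon]$; $s(t,v)=\sum_{e\in D(v)}t(e)$. $t$ is $\alpha$-almost supermagic if $|s(t,u)-s(t,v)|\le\alpha$ for all vertices $u,v$. A $p$-swap of $t$ is a map $\theta$ sending $t$ to another edge labeling $\theta t$ with $|t(e)-\theta t(e)|\le p$ for all $e\in E$. $R(p,t,n)=\max_{\theta}\max_{u\ne v}|s(\theta t,u)-s(\theta t,v)|$, the outer maximum over all $p$-swaps $\theta$ of $t$. *)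

theory Defs
  imports Complex_Main "HOL-Library.Ramsey"
begin

text \<open>The vertex set of the complete graph is an arbitrary finite set \<open>V\<close>; its edges are
  the two-element subsets of \<open>V\<close>, i.e. the library's \<open>nsets V 2\<close>, and \<open>D V v\<close> are the
  edges containing \<open>v\<close>.  Only the values of a labeling on edges matter.\<close>

abbreviation edges :: "'a set \<Rightarrow> 'a set set" where
  "edges V \<equiv> nsets V 2"

definition D :: "'a set \<Rightarrow> 'a \<Rightarrow> 'a set set" where
  "D V v = {e \<in> edges V. v \<in> e}"

definition edge_labeling :: "'a set \<Rightarrow> ('a set \<Rightarrow> nat) \<Rightarrow> bool" where
  "edge_labeling V t \<longleftrightarrow> bij_betw t (edges V) {1..card V choose 2}"

definition s :: "'a set \<Rightarrow> ('a set \<Rightarrow> nat) \<Rightarrow> 'a \<Rightarrow> nat" where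
  "s V t v = (\<Sum>e\<in>D V v. t e)"

definition almost_supermagic :: "'a set \<Rightarrow> real \<Rightarrow> ('a set \<Rightarrow> nat) \<Rightarrow> bool" where
  "almost_supermagic V \<alpha> t \<longleftrightarrow>
     (\<forall>u\<in>V. \<forall>v\<in>V. \<bar>real (s V t u) - real (s V t v)\<bar> \<le> \<alpha>)"

text \<open>A \<open>p\<close>-swap is a map on labelings, constrained only at the labeling \<open>t\<close> in question;
  the identity is a \<open>p\<close>-swap.\<close>

definition p_swap :: "'a set \<Rightarrow> nat \<Rightarrow> ('a set \<Rightarrow> nat) \<Rightarrow>
    (('a set \<Rightarrow> nat) \<Rightarrow> ('a set \<Rightarrow> nat)) \<Rightarrow> bool" where
  "p_swap V p t \<theta> \<longleftrightarrow>
     edge_labeling V (\<theta> t) \<and> (\<forall>e\<in>edges V. \<bar>int (t e) - int (\<theta> t e)\<bar> \<le> int p)"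

definition max_diff :: "'a set \<Rightarrow> ('a set \<Rightarrow> nat) \<Rightarrow> int" where
  "max_diff V t = Max {\<bar>int (s V t u) - int (s V t v)\<bar> | u v. u \<in> V \<and> v \<in> V \<and> u \<noteq> v}"

text \<open>There may be infinitely many \<open>\<theta>\<close>, but \<open>max_diff V (\<theta> t)\<close> depends only on the
  restriction of \<open>\<theta> t\<close> to the edges, so the outer maximum is over a finite set, nonempty
  because of the identity.\<close>

definition R :: "'a set \<Rightarrow> nat \<Rightarrow> ('a set \<Rightarrow> nat) \<Rightarrow> int" where
  "R V p t = Max {max_diff V (\<theta> t) | \<theta>. p_swap V p t \<theta>}"

lemma R_set_finite_nonempty:
  assumes "finite V" "edge_labeling V t"
  shows "finite {max_diff V (\<theta> t) | \<theta>. p_swap V p t \<theta>}"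
    and "{max_diff V (\<theta> t) | \<theta>. p_swap V p t \<theta>} \<noteq> {}"
proof -
  let ?E = "edges V" and ?B = "{1..card V choose 2}"
  have restr: "max_diff V f = max_diff V (restrict f ?E)" for f
  proof -
    have "s V f v = s V (restrict f ?E) v" for v
      unfolding s_def by (rule sum.cong) (auto simp: D_def)
    then show ?thesis unfolding max_diff_def by presburger
  qed
  have "{max_diff V (\<theta> t) | \<theta>. p_swap V p t \<theta>} \<subseteq> max_diff V ` (?E \<rightarrow>\<^sub>E ?B)"
  proof
    fix x assume "x \<in> {max_diff V (\<theta> t) | \<theta>. p_swap V p t \<theta>}"
    then obtain \<theta> where x: "x = max_diff V (\<theta> t)" and "p_swap V p t \<theta>" by blast
    then have "bij_betw (\<theta> t) ?E ?B" by (simp add: p_swap_def edge_labeling_def)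
    then have "restrict (\<theta> t) ?E \<in> ?E \<rightarrow>\<^sub>E ?B"
      by (auto simp: PiE_iff dest: bij_betwE)
    then show "x \<in> max_diff V ` (?E \<rightarrow>\<^sub>E ?B)"
      using x restr[of "\<theta> t"] by simp
  qed
  moreover have "finite (?E \<rightarrow>\<^sub>E ?B)"
    by (intro finite_PiE finite_imp_finite_nsets assms(1)) auto
  ultimately show "finite {max_diff V (\<theta> t) | \<theta>. p_swap V p t \<theta>}"
    by (rule finite_subset[OF _ finite_imageI])
  have "p_swap V p t (\<lambda>f. f)" using assms(2) by (simp add: p_swap_def)
  then show "{max_diff V (\<theta> t) | \<theta>. p_swap V p t \<theta>} \<noteq> {}" by blast
qed

end

theory Submission
  imports Defs
begin

text \<open>For vertices \<open>u \<noteq> v\<close> call a label \<open>U\<close> if its edge contains \<open>u\<close> but not \<open>v\<close>, and \<open>W\<close> if its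
  edge contains \<open>v\<close> but not \<open>u\<close>.  Exchange the labels \<open>i\<close> and \<open>i + p\<close> whenever \<open>i\<close> is \<open>U\<close> and
  \<open>i + p\<close> is not, and whenever \<open>i + p\<close> is \<open>W\<close>, \<open>i\<close> is not, and \<open>i - p\<close> is not \<open>U\<close>.  These
  transpositions are disjoint, and each of the \<open>2 (n - 2)\<close> labels that are \<open>U\<close> or \<open>W\<close> raises the
  difference of the sums at \<open>u\<close> and \<open>v\<close> by \<open>p\<close>, up to one loss for each pattern \<open>U, U\<close> or \<open>W, W\<close>
  at distance \<open>p\<close>, each \<open>U, W\<close> at distance \<open>2 p\<close>, each \<open>U\<close> among the last \<open>p\<close> labels and each
  \<open>W\<close> among the first \<open>p\<close>.  Distinct edges share at most one vertex, so averaged over all ordered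
  pairs \<open>(u, v)\<close> the loss is at most \<open>n + 1 + 4 p / n\<close>.\<close>

section \<open>Exchanging labels at distance \<open>p\<close>\<close>

text \<open>By the hypothesis on \<open>M\<close> the pairs \<open>i\<close>, \<open>i + p\<close>
  with \<open>i\<close> in \<open>M\<close> are disjoint, so exchanging within each of them is an
  involution. One exchange raises the factor of \<open>c i\<close> by \<open>p\<close> and lowers
  that of \<open>c (i + p)\<close> by \<open>p\<close>.\<close>

lemma disjoint_shifts_permutation:
  fixes M :: "nat set" and N p :: nat
  assumes M: "M \<subseteq> {1..N - p}" and dis: "\<And>i. i \<in> M \<Longrightarrow> i + p \<notin> M"
  obtains \<pi> :: "nat \<Rightarrow> nat"
  where "bij_betw \<pi> {1..N} {1..N}"
    and "\<And>j. \<bar>int j - int (\<pi> j)\<bar> \<le> int p"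
    and "\<And>c :: nat \<Rightarrow> int. (\<Sum>j=1..N. c j * int (\<pi> j)) =
           (\<Sum>j=1..N. c j * int j) + int p * (\<Sum>i\<in>M. c i - c (i + p))"
proof
  define \<pi> where "\<pi> j = (if j \<in> M then j + p else if j \<ge> p \<and> j - p \<in> M then j - p else j)" for j
  have rng: "1 \<le> i \<and> i + p \<le> N" if "i \<in> M" for i
    using M that by fastforce
  have inv: "\<pi> (\<pi> j) = j" for j
    using dis[of j] dis[of "j - p"] by (auto simp: \<pi>_def)
  have into: "\<pi> j \<in> {1..N}" if "j \<in> {1..N}" for j
    using that rng[of j] rng[of "j - p"] by (auto simp: \<pi>_def)
  show "bij_betw \<pi> {1..N} {1..N}"
    by (rule bij_betw_byWitness[where f' = \<pi>]) (use inv into in auto)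
  show "\<bar>int j - int (\<pi> j)\<bar> \<le> int p" for j
    by (auto simp: \<pi>_def)
  fix c :: "nat \<Rightarrow> int"
  have sub: "M \<subseteq> {1..N}" "(\<lambda>i. i + p) ` M \<subseteq> {1..N}"
    using rng by force+
  \<comment> \<open>Since \<open>M\<close> and its shift by \<open>p\<close> are disjoint, the three
    cases of \<open>\<pi>\<close> become two indicator terms that can be summed separately.\<close>
  have step: "c j * int (\<pi> j) = c j * int j + (if j \<in> M then int p * c j else 0)
      - (if j \<in> (\<lambda>i. i + p) ` M then int p * c j else 0)" for j
  proof -
    have im: "j \<in> (\<lambda>i. i + p) ` M \<longleftrightarrow> j \<ge> p \<and> j - p \<in> M"
      by (metis (no_types, lifting) add_diff_cancel_right' image_iff le_add2 le_add_diff_inverse2)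
    show ?thesis
      using dis[of "j - p"] unfolding im \<pi>_def
      by (auto simp: algebra_simps of_nat_diff)
  qed
  have 1: "(\<Sum>j=1..N. if j \<in> M then int p * c j else 0) = (\<Sum>i\<in>M. int p * c i)"
    using sub(1) by (simp add: sum.inter_restrict[symmetric] Int_absorb1)
  have "(\<Sum>j=1..N. if j \<in> (\<lambda>i. i + p) ` M then int p * c j else 0)
      = (\<Sum>j\<in>(\<lambda>i. i + p) ` M. int p * c j)"
    using sub(2) by (simp only: sum.inter_restrict[symmetric] finite_atLeastAtMost Int_absorb1)
  also have "\<dots> = (\<Sum>i\<in>M. int p * c (i + p))"
    by (simp add: sum.reindex inj_on_def)
  finally have 2: "(\<Sum>j=1..N. if j \<in> (\<lambda>i. i + p) ` M then int p * c j else 0)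
      = (\<Sum>i\<in>M. int p * c (i + p))" .
  show "(\<Sum>j=1..N. c j * int (\<pi> j)) =
      (\<Sum>j=1..N. c j * int j) + int p * (\<Sum>i\<in>M. c i - c (i + p))"
    unfolding step sum_subtractf sum.distrib 1 2
    by (simp add: sum_distrib_left right_diff_distrib sum_subtractf)
qed

section \<open>Gain and loss for a fixed pair of colours\<close>

text \<open>The third pattern is indexed by its middle label, the lower partner that the
  \<open>W\<close> label cannot safely use. For \<open>p \<ge> N\<close>, truncated subtraction
  empties the first three ranges and the last two become \<open>{1..N}\<close>, so large
  \<open>p\<close> needs no separate treatment.\<close>

definition loss :: "nat \<Rightarrow> nat \<Rightarrow> (nat \<Rightarrow> bool) \<Rightarrow> (nat \<Rightarrow> bool) \<Rightarrow> nat" where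
  "loss N p U W =
     card {i \<in> {1..N - p}. U i \<and> U (i + p)} + card {i \<in> {1..N - p}. W i \<and> W (i + p)}
   + card {i \<in> {p<..N - p}. U (i - p) \<and> W (i + p)}
   + card {i \<in> {N - p<..N}. U i} + card {i \<in> {1..min p N}. W i}"

lemma two_colour_permutation:
  fixes U W :: "nat \<Rightarrow> bool" and N p :: nat
  assumes UW: "\<And>j. \<not> (U j \<and> W j)"
  defines "c j \<equiv> of_bool (U j) - (of_bool (W j) :: int)"
  obtains \<pi> :: "nat \<Rightarrow> nat"
  where "bij_betw \<pi> {1..N} {1..N}"
    and "\<And>j. \<bar>int j - int (\<pi> j)\<bar> \<le> int p"
    and "(\<Sum>j=1..N. c j * int (\<pi> j)) \<ge> (\<Sum>j=1..N. c j * int j) +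
           int p * (int (card {j \<in> {1..N}. U j}) + int (card {j \<in> {1..N}. W j}) - int (loss N p U W))"
proof -
  define A where "A = {i \<in> {1..N - p}. U i \<and> \<not> U (i + p)}"
  \<comment> \<open>Here \<open>i + p\<close> is the \<open>W\<close> label that moves down. If
    \<open>i - p\<close> is \<open>U\<close> and \<open>i\<close> is not, then \<open>i\<close> is
    already the upper partner of \<open>i - p\<close> in \<open>A\<close>. The guard
    \<open>i > p\<close> keeps truncated subtraction from consulting \<open>U 0\<close>, which is
    not the colour of a label.\<close>
  define B where "B = {i \<in> {1..N - p}. W (i + p) \<and> \<not> W i \<and> \<not> (i > p \<and> U (i - p))}"
  have sub: "A \<union> B \<subseteq> {1..N - p}" by (auto simp: A_def B_def)
  have fin: "finite A" "finite B" by (auto simp: A_def B_def)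
  \<comment> \<open>For \<open>i\<close> in \<open>A\<close>, the failure of
    \<open>U (i + p)\<close> keeps \<open>i + p\<close> out of \<open>A\<close>, and
    \<open>U i\<close> keeps it out of \<open>B\<close>. For \<open>i\<close> in \<open>B\<close>,
    \<open>W (i + p)\<close> keeps it out of \<open>B\<close> and, the colours being exclusive, out
    of \<open>A\<close>.\<close>
  have dis: "i + p \<notin> A \<union> B" if "i \<in> A \<union> B" for i
    using that UW[of "i + p"] by (auto simp: A_def B_def)
  obtain \<pi> :: "nat \<Rightarrow> nat" where \<pi>: "bij_betw \<pi> {1..N} {1..N}"
      "\<And>j. \<bar>int j - int (\<pi> j)\<bar> \<le> int p"
      "\<And>c :: nat \<Rightarrow> int. (\<Sum>j=1..N. c j * int (\<pi> j)) =
           (\<Sum>j=1..N. c j * int j) + int p * (\<Sum>i\<in>A \<union> B. c i - c (i + p))"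
    by (rule disjoint_shifts_permutation[OF sub dis], assumption) (rule that)
  \<comment> \<open>\<open>A\<close> and \<open>B\<close> may overlap: an index in both has
    \<open>U i\<close> and \<open>W (i + p)\<close>, and its single exchange contributes 2. Summing
    two indicators counts it twice, as required.\<close>
  have "(A \<union> B) \<inter> {i. i \<in> A} = A" "(A \<union> B) \<inter> {i. i \<in> B} = B" by auto
  then have "int (card A + card B) = (\<Sum>i\<in>A \<union> B. of_bool (i \<in> A) + of_bool (i \<in> B))"
    using fin by (simp only: sum.distrib sum_of_bool_eq finite_Un of_nat_add simp_thms)
  also have "\<dots> \<le> (\<Sum>i\<in>A \<union> B. c i - c (i + p))"
  proof (rule sum_mono)
    fix i assume "i \<in> A \<union> B"
    then show "of_bool (i \<in> A) + of_bool (i \<in> B) \<le> c i - c (i + p)"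
      using UW[of i] UW[of "i + p"] by (auto simp: A_def B_def c_def)
  qed
  finally have AB: "int (card A + card B) \<le> (\<Sum>i\<in>A \<union> B. c i - c (i + p))" .

  have "card {j \<in> {1..N}. U j} \<le>
      card (A \<union> {i \<in> {1..N - p}. U i \<and> U (i + p)} \<union> {i \<in> {N - p<..N}. U i})"
    by (rule card_mono) (auto simp: A_def)
  also have "\<dots> \<le> card A + card {i \<in> {1..N - p}. U i \<and> U (i + p)} + card {i \<in> {N - p<..N}. U i}"
    by (intro order.trans[OF card_Un_le] add_mono card_Un_le order.refl)
  finally have a: "card {j \<in> {1..N}. U j} \<le> \<dots>" .
  let ?f = "\<lambda>i. i + p"
  let ?WW = "{i \<in> {1..N - p}. W i \<and> W (i + p)}"
  let ?UW = "{i \<in> {p<..N - p}. U (i - p) \<and> W (i + p)}"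
  let ?W = "{i \<in> {1..min p N}. W i}"
  \<comment> \<open>Every \<open>W\<close> label above \<open>p\<close> is traced back to its lower
    partner, which lies in \<open>B\<close> unless it is itself \<open>W\<close> or has a
    \<open>U\<close> label at distance \<open>p\<close> below it.\<close>
  have "{j \<in> {1..N}. W j} \<subseteq> ?f ` (B \<union> ?WW \<union> ?UW) \<union> ?W"
  proof
    fix j assume j: "j \<in> {j \<in> {1..N}. W j}"
    show "j \<in> ?f ` (B \<union> ?WW \<union> ?UW) \<union> ?W"
    proof (cases "j \<le> p")
      case False
      then obtain i where "j = i + p" "i \<ge> 1"
        by (metis add.commute less_imp_add_positive not_le less_eq_Suc_le One_nat_def)
      with j have "i \<in> B \<union> ?WW \<union> ?UW" by (auto simp: B_def)
      with \<open>j = i + p\<close> show ?thesis by blast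
    qed (use j in auto)
  qed
  hence "card {j \<in> {1..N}. W j} \<le> card (?f ` (B \<union> ?WW \<union> ?UW) \<union> ?W)"
    by (rule card_mono[rotated]) (use fin in auto)
  also have "\<dots> \<le> card (?f ` (B \<union> ?WW \<union> ?UW)) + card ?W"
    by (rule card_Un_le)
  also have "card (?f ` (B \<union> ?WW \<union> ?UW)) \<le> card (B \<union> ?WW \<union> ?UW)"
    by (rule card_image_le) (use fin in auto)
  also have "\<dots> \<le> card B + card ?WW + card ?UW"
    by (intro order.trans[OF card_Un_le] add_mono card_Un_le order.refl)
  finally have b: "card {j \<in> {1..N}. W j} \<le> card B + card ?WW + card ?UW + card ?W"
    by simp
  have "int (card {j \<in> {1..N}. U j}) + int (card {j \<in> {1..N}. W j}) - int (loss N p U W)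
      \<le> (\<Sum>i\<in>A \<union> B. c i - c (i + p))"
    using a b AB unfolding loss_def by linarith
  hence "int p * (int (card {j \<in> {1..N}. U j}) + int (card {j \<in> {1..N}. W j}) - int (loss N p U W))
      \<le> int p * (\<Sum>i\<in>A \<union> B. c i - c (i + p))"
    by (rule mult_left_mono) simp
  then show ?thesis
    by (intro that[OF \<pi>(1,2)]) (simp only: \<pi>(3) add_left_mono)
qed

section \<open>Averaging the loss over ordered pairs of vertices\<close>

text \<open>Interchanging the sums lets the loss be estimated label by label, through the number of
  vertex pairs that realize a pattern at a given label.\<close>

lemma double_count_le:
  assumes "finite P" "finite I" "\<And>i. i \<in> I \<Longrightarrow> card {x \<in> P. Q x i} \<le> k"
  shows "(\<Sum>x\<in>P. card {i \<in> I. Q x i}) \<le> card I * k"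
proof -
  have "(\<Sum>x\<in>P. card {i \<in> I. Q x i}) = (\<Sum>i\<in>I. card {x \<in> P. Q x i})"
    using sum_multicount_gen[OF assms(1,2), of Q "\<lambda>i. card {x \<in> P. Q x i}"] by simp
  also have "\<dots> \<le> card I * k"
    using sum_bounded_above[of I _ k] assms(3) by simp
  finally show ?thesis .
qed

text \<open>With \<open>g\<close> sending a label to its edge, \<open>excl g u v\<close> is the
  colour \<open>U\<close> and \<open>excl g v u\<close> the colour \<open>W\<close>.\<close>

abbreviation excl :: "(nat \<Rightarrow> 'a set) \<Rightarrow> 'a \<Rightarrow> 'a \<Rightarrow> nat \<Rightarrow> bool" where
  "excl g u v j \<equiv> u \<in> g j \<and> v \<notin> g j"

lemma card_pairs_fst_in:
  assumes "finite V" "X \<subseteq> V"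
  shows "card {(u, v) \<in> V \<times> V. u \<noteq> v \<and> u \<in> X} = card X * (card V - 1)"
    and "card {(u, v) \<in> V \<times> V. u \<noteq> v \<and> v \<in> X} = card X * (card V - 1)"
proof -
  have fX: "finite X" using assms finite_subset by blast
  have "{(u, v) \<in> V \<times> V. u \<noteq> v \<and> u \<in> X} = (SIGMA u:X. V - {u})"
    using assms by auto
  also have "card \<dots> = (\<Sum>u\<in>X. card (V - {u}))"
    using assms fX by (intro card_SigmaI) auto
  also have "\<dots> = (\<Sum>u\<in>X. card V - 1)"
    using assms by (intro sum.cong) auto
  finally show 1: "card {(u, v) \<in> V \<times> V. u \<noteq> v \<and> u \<in> X} = card X * (card V - 1)"
    by simp
  have "{(u, v) \<in> V \<times> V. u \<noteq> v \<and> v \<in> X} = prod.swap ` {(u, v) \<in> V \<times> V. u \<noteq> v \<and> u \<in> X}"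
    by (auto simp: image_iff)
  then show "card {(u, v) \<in> V \<times> V. u \<noteq> v \<and> v \<in> X} = card X * (card V - 1)"
    using 1 by (simp add: card_image)
qed

lemma nsets_2_card_Int_le:
  assumes "e \<in> nsets V 2" "f \<in> nsets V 2" "e \<noteq> f"
  shows "card (e \<inter> f) \<le> 1"
proof (rule ccontr)
  have e: "finite e" "card e = 2" "finite f" "card f = 2"
    using assms by (auto simp: nsets_def)
  assume "\<not> card (e \<inter> f) \<le> 1"
  then have "card e \<le> card (e \<inter> f)" "card f \<le> card (e \<inter> f)" using e by auto
  then have "e \<inter> f = e" "e \<inter> f = f"
    using card_seteq[of e "e \<inter> f"] card_seteq[of f "e \<inter> f"] e by blast+
  then show False using assms(3) by simp
qed

text \<open>A repeated colour at distance \<open>p\<close> confines one vertex to the intersection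
  of two distinct edges, at most one choice, and leaves \<open>card V - 1\<close> for the other. A
  \<open>U\<close>, \<open>W\<close> pattern takes one endpoint from each of two edges, at most 4
  pairs. A boundary label allows 2 endpoints, and each end has at most \<open>p\<close> such
  labels.\<close>

lemma sum_loss_le:
  fixes V :: "'a set" and g :: "nat \<Rightarrow> 'a set"
  assumes V: "finite V" and g: "inj_on g {1..N}" "g ` {1..N} \<subseteq> edges V" and "p \<ge> 1"
  shows "(\<Sum>(u, v) | u \<in> V \<and> v \<in> V \<and> u \<noteq> v. loss N p (excl g u v) (excl g v u))
     \<le> 2 * N * (card V - 1) + 4 * N + 4 * p * (card V - 1)"
proof -
  define P where "P = {(u, v) \<in> V \<times> V. u \<noteq> v}"
  let ?m = "card V - 1"
  have fP: "finite P" unfolding P_def by (rule finite_subset[of _ "V \<times> V"]) (use V in auto)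
  have edge: "g i \<subseteq> V" "finite (g i)" "card (g i) = 2" "g i \<in> edges V" if "i \<in> {1..N}" for i
    using subsetD[OF g(2) imageI[OF that]] by (simp_all add: nsets_def)
  have share: "card (g i \<inter> g (i + p)) \<le> 1" if "i \<in> {1..N - p}" for i
  proof (rule nsets_2_card_Int_le)
    have i: "i \<in> {1..N}" "i + p \<in> {1..N}" using that by auto
    then show "g i \<in> edges V" "g (i + p) \<in> edges V" using edge by auto
    show "g i \<noteq> g (i + p)" using inj_onD[OF g(1) _ i] \<open>p \<ge> 1\<close> by auto
  qed
  have fst_le: "card {x \<in> P. Q x} \<le> card X * ?m" if "X \<subseteq> V" "\<And>u v. Q (u, v) \<Longrightarrow> u \<in> X" for Q X
    unfolding card_pairs_fst_in(1)[OF V that(1), symmetric]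
    by (rule card_mono, rule finite_subset[of _ "V \<times> V"]) (use V that in \<open>auto simp: P_def\<close>)
  have snd_le: "card {x \<in> P. Q x} \<le> card X * ?m" if "X \<subseteq> V" "\<And>u v. Q (u, v) \<Longrightarrow> v \<in> X" for Q X
    unfolding card_pairs_fst_in(2)[OF V that(1), symmetric]
    by (rule card_mono, rule finite_subset[of _ "V \<times> V"]) (use V that in \<open>auto simp: P_def\<close>)
  have UU: "(\<Sum>x\<in>P. card {i \<in> {1..N - p}. excl g (fst x) (snd x) i \<and>
      excl g (fst x) (snd x) (i + p)}) \<le> card {1..N - p} * ?m"
  proof (rule double_count_le[OF fP])
    fix i assume i: "i \<in> {1..N - p}"
    then have "i \<in> {1..N}" by auto
    have "card {x \<in> P. excl g (fst x) (snd x) i \<and> excl g (fst x) (snd x) (i + p)}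
        \<le> card (g i \<inter> g (i + p)) * ?m"
      by (rule fst_le) (use edge[OF \<open>i \<in> {1..N}\<close>] in auto)
    also have "\<dots> \<le> 1 * ?m" by (rule mult_right_mono[OF share[OF i]]) simp
    finally show "card {x \<in> P. excl g (fst x) (snd x) i \<and>
        excl g (fst x) (snd x) (i + p)} \<le> ?m" by simp
  qed simp
  have WW: "(\<Sum>x\<in>P. card {i \<in> {1..N - p}. excl g (snd x) (fst x) i \<and>
      excl g (snd x) (fst x) (i + p)}) \<le> card {1..N - p} * ?m"
  proof (rule double_count_le[OF fP])
    fix i assume i: "i \<in> {1..N - p}"
    then have "i \<in> {1..N}" by auto
    have "card {x \<in> P. excl g (snd x) (fst x) i \<and> excl g (snd x) (fst x) (i + p)}
        \<le> card (g i \<inter> g (i + p)) * ?m"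
      by (rule snd_le) (use edge[OF \<open>i \<in> {1..N}\<close>] in auto)
    also have "\<dots> \<le> 1 * ?m" by (rule mult_right_mono[OF share[OF i]]) simp
    finally show "card {x \<in> P. excl g (snd x) (fst x) i \<and>
        excl g (snd x) (fst x) (i + p)} \<le> ?m" by simp
  qed simp
  have UW: "(\<Sum>x\<in>P. card {i \<in> {p<..N - p}. excl g (fst x) (snd x) (i - p) \<and>
      excl g (snd x) (fst x) (i + p)}) \<le> card {p<..N - p} * 4"
  proof (rule double_count_le[OF fP])
    fix i assume "i \<in> {p<..N - p}"
    then have i: "i - p \<in> {1..N}" "i + p \<in> {1..N}" by auto
    have "card {x \<in> P. excl g (fst x) (snd x) (i - p) \<and> excl g (snd x) (fst x) (i + p)}
        \<le> card (g (i - p) \<times> g (i + p))"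
      by (rule card_mono) (use edge i in auto)
    also have "\<dots> = 4" using edge(3)[OF i(1)] edge(3)[OF i(2)] by (simp add: card_cartesian_product)
    finally show "card {x \<in> P. excl g (fst x) (snd x) (i - p) \<and>
        excl g (snd x) (fst x) (i + p)} \<le> 4" .
  qed simp
  have Ulast: "(\<Sum>x\<in>P. card {i \<in> {N - p<..N}. excl g (fst x) (snd x) i})
      \<le> card {N - p<..N} * (2 * ?m)"
  proof (rule double_count_le[OF fP])
    fix i assume "i \<in> {N - p<..N}"
    then have i: "i \<in> {1..N}" by auto
    show "card {x \<in> P. excl g (fst x) (snd x) i} \<le> 2 * ?m"
      unfolding edge(3)[OF i, symmetric] by (rule fst_le) (use edge(1)[OF i] in auto)
  qed simp
  have Wfirst: "(\<Sum>x\<in>P. card {i \<in> {1..min p N}. excl g (snd x) (fst x) i})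
      \<le> card {1..min p N} * (2 * ?m)"
  proof (rule double_count_le[OF fP])
    fix i assume "i \<in> {1..min p N}"
    then have i: "i \<in> {1..N}" by auto
    show "card {x \<in> P. excl g (snd x) (fst x) i} \<le> 2 * ?m"
      unfolding edge(3)[OF i, symmetric] by (rule snd_le) (use edge(1)[OF i] in auto)
  qed simp
  have "{(u, v). u \<in> V \<and> v \<in> V \<and> u \<noteq> v} = P" by (auto simp: P_def)
  hence "(\<Sum>(u, v) | u \<in> V \<and> v \<in> V \<and> u \<noteq> v. loss N p (excl g u v) (excl g v u))
      = (\<Sum>x\<in>P. loss N p (excl g (fst x) (snd x)) (excl g (snd x) (fst x)))"
    by (simp add: case_prod_unfold)
  also have "\<dots> \<le> card {1..N - p} * ?m + card {1..N - p} * ?m + card {p<..N - p} * 4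
      + card {N - p<..N} * (2 * ?m) + card {1..min p N} * (2 * ?m)"
    unfolding loss_def sum.distrib by (intro add_mono UU WW UW Ulast Wfirst)
  also have "\<dots> \<le> N * ?m + N * ?m + N * 4 + p * (2 * ?m) + p * (2 * ?m)"
    by (intro add_mono mult_right_mono) auto
  finally show ?thesis by (simp add: algebra_simps)
qed

text \<open>There are \<open>2 * N\<close> ordered pairs, so \<open>sum_loss_le\<close> gives an
  average of at most \<open>n + 1 + 4 p / n\<close>, hence at most \<open>n + 1 + 2 p\<close> as
  \<open>n \<ge> 2\<close>. The constant 15 is what turns \<open>2 (n - 2)\<close> minus the loss
  into \<open>n - 2 p - 19\<close>.\<close>

lemma exists_pair_small_loss:
  fixes V :: "'a set" and g :: "nat \<Rightarrow> 'a set"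
  assumes V: "finite V" "card V = n" "n \<ge> 2" and N: "N = n choose 2" and "p \<ge> 1"
    and g: "bij_betw g {1..N} (edges V)"
  obtains (small) u v where "u \<in> V" "v \<in> V" "u \<noteq> v"
    and "loss N p (excl g u v) (excl g v u) \<le> n + 2 * p + 15"
proof (rule ccontr)
  assume neg: "\<not> thesis"
  \<comment> \<open>A weak inequality is enough here: the slack between the constants 1 and 15 makes
    the final comparison strict.\<close>
  have big: "n + 2 * p + 15 \<le> loss N p (excl g u v) (excl g v u)"
    if "u \<in> V" "v \<in> V" "u \<noteq> v" for u v
    using small[OF that] neg by (meson nat_le_linear)
  let ?P = "{(u, v) \<in> V \<times> V. u \<noteq> v}"
  have P: "{(u, v). u \<in> V \<and> v \<in> V \<and> u \<noteq> v} = ?P" by auto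
  have cP: "card ?P = n * (n - 1)"
  proof -
    have "?P = {(u, v) \<in> V \<times> V. u \<noteq> v \<and> u \<in> V}" by auto
    then show ?thesis using card_pairs_fst_in(1)[OF V(1) order.refl] V(2) by simp
  qed
  have "even (n * (n - 1))" using V(3) by auto
  then have N2: "2 * N = n * (n - 1)" by (simp only: N choose_two dvd_mult_div_cancel)
  have "n * (n - 1) * (n + 2 * p + 15) \<le>
      (\<Sum>(u, v) | u \<in> V \<and> v \<in> V \<and> u \<noteq> v. loss N p (excl g u v) (excl g v u))"
    unfolding P cP[symmetric]
    using sum_bounded_below[of ?P "n + 2 * p + 15"
        "\<lambda>(u, v). loss N p (excl g u v) (excl g v u)"] big by auto
  also have "\<dots> \<le> 2 * N * (n - 1) + 4 * N + 4 * p * (n - 1)"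
    using sum_loss_le[OF V(1), of g N p] g \<open>p \<ge> 1\<close> V(2) by (auto simp: bij_betw_def)
  also have "\<dots> = n * (n - 1) * (n - 1) + 2 * (n * (n - 1)) + 4 * p * (n - 1)"
    using N2 by simp
  \<comment> \<open>Uses \<open>2 \<le> n\<close> to replace one factor 2 of
    \<open>4 * p * (n - 1)\<close> by \<open>n\<close>.\<close>
  also have "\<dots> \<le> n * (n - 1) * (n - 1) + 2 * (n * (n - 1)) + (n * (n - 1)) * (2 * p)"
    using mult_le_mono1[OF V(3), of "2 * p * (n - 1)"] by (simp add: ac_simps)
  also have "\<dots> = n * (n - 1) * (n - 1 + 2 + 2 * p)" by (simp only: distrib_left ac_simps)
  also have "\<dots> < n * (n - 1) * (n + 2 * p + 15)"
    using V(3) by (intro mult_strict_left_mono) auto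
  finally show False by simp
qed

section \<open>Differences of vertex sums\<close>

lemma finite_D: "finite V \<Longrightarrow> finite (D V v)"
  unfolding D_def by (simp add: finite_imp_finite_nsets)

lemma card_D_Diff:
  assumes "finite V" "card V = n" "u \<in> V" "v \<in> V" "u \<noteq> v"
  shows "card (D V u - D V v) = n - 2"
proof -
  have "D V u - D V v = (\<lambda>w. {u, w}) ` (V - {u, v})"
  proof (intro equalityI subsetI)
    fix e assume "e \<in> D V u - D V v"
    then have e: "e \<subseteq> V" "card e = 2" "u \<in> e" "v \<notin> e" by (auto simp: D_def nsets_def)
    then obtain w where "e = {u, w}" "w \<noteq> u" by (metis card_2_iff doubleton_eq_iff insertE singletonD)
    then show "e \<in> (\<lambda>w. {u, w}) ` (V - {u, v})" using e by auto
  qed (use assms in \<open>auto simp: D_def nsets_def\<close>)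
  moreover have "inj_on (\<lambda>w. {u, w}) (V - {u, v})" by (auto simp: inj_on_def doubleton_eq_iff)
  ultimately show ?thesis
    using assms by (simp add: card_image card_Diff_subset)
qed

text \<open>Edges at both vertices cancel. For distinct \<open>u\<close> and \<open>v\<close> this
  removes the edge joining them, so the upper bound has \<open>2 n - 4\<close> rather than
  \<open>2 n - 2\<close>.\<close>

lemma s_diff:
  assumes "finite V"
  shows "int (s V f u) - int (s V f v) =
    (\<Sum>e\<in>D V u - D V v. int (f e)) - (\<Sum>e\<in>D V v - D V u. int (f e))"
proof -
  have "(\<Sum>e\<in>D V a. int (f e)) = (\<Sum>e\<in>D V a \<inter> D V b. int (f e)) + (\<Sum>e\<in>D V a - D V b. int (f e))"
    for a b by (rule sum.Int_Diff[OF finite_D[OF assms]])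
  from this[of u v] this[of v u] show ?thesis
    unfolding s_def by (simp add: Int_commute)
qed

lemma finite_max_diff_set:
  assumes "finite V"
  shows "finite {\<bar>int (s V t u) - int (s V t v)\<bar> | u v. u \<in> V \<and> v \<in> V \<and> u \<noteq> v}"
  by (rule finite_subset[of _ "(\<lambda>(u, v). \<bar>int (s V t u) - int (s V t v)\<bar>) ` (V \<times> V)"])
    (use assms in auto)

text \<open>After cancellation \<open>n - 2\<close> edges remain on each side, and each of their
  labels moves by at most \<open>p\<close>.\<close>

lemma s_diff_swap_le:
  assumes V: "finite V" "card V = n" "n \<ge> 2" and uv: "u \<in> V" "v \<in> V" "u \<noteq> v"
    and sw: "p_swap V p t \<theta>"
  shows "\<bar>int (s V (\<theta> t) u) - int (s V (\<theta> t) v)\<bar>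
    \<le> \<bar>int (s V t u) - int (s V t v)\<bar> + (2 * int n - 4) * int p"
proof -
  have b: "\<bar>(\<Sum>e\<in>X. int (\<theta> t e)) - (\<Sum>e\<in>X. int (t e))\<bar> \<le> int (n - 2) * int p"
    if "X \<subseteq> edges V" "card X = n - 2" for X
  proof -
    have "\<bar>(\<Sum>e\<in>X. int (\<theta> t e)) - (\<Sum>e\<in>X. int (t e))\<bar> \<le> (\<Sum>e\<in>X. \<bar>int (\<theta> t e) - int (t e)\<bar>)"
      unfolding sum_subtractf[symmetric] by (rule sum_abs)
    also have "\<dots> \<le> int (card X) * int p"
      by (rule sum_bounded_above) (use sw that(1) in \<open>auto simp: p_swap_def abs_minus_commute\<close>)
    finally show ?thesis using that(2) by simp
  qed
  have "D V w \<subseteq> edges V" for w by (auto simp: D_def)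
  then have sub: "D V a - D V b \<subseteq> edges V" for a b by blast
  have n: "(2 * int n - 4) * int p = int (n - 2) * int p + int (n - 2) * int p"
    using V(3) by (simp add: of_nat_diff algebra_simps)
  show ?thesis
    unfolding s_diff[OF V(1)] n
    using b[OF sub card_D_Diff[OF V(1,2) uv]]
      b[OF sub card_D_Diff[OF V(1,2) uv(2,1) uv(3)[symmetric]]]
    by linarith
qed

text \<open>Moves the sum from edges to labels, where the permutation lemmas apply. It serves the
  original labeling with \<open>h\<close> the identity and the swapped one with \<open>h\<close> the
  permutation.\<close>

lemma s_diff_via_labels:
  assumes "finite V" and g: "bij_betw g {1..N} (edges V)" and f: "\<And>j. j \<in> {1..N} \<Longrightarrow> f (g j) = h j"
  shows "int (s V f u) - int (s V f v) =
    (\<Sum>j=1..N. (of_bool (excl g u v j) - of_bool (excl g v u j)) * int (h j))"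
proof -
  have fin: "finite (edges V)" by (simp add: assms(1) finite_imp_finite_nsets)
  have "int (s V f w) = (\<Sum>e\<in>edges V. of_bool (w \<in> e) * int (f e))" for w
    unfolding s_def D_def of_nat_sum sum.inter_filter[OF fin] by (rule sum.cong) auto
  hence "int (s V f u) - int (s V f v) =
      (\<Sum>e\<in>edges V. (of_bool (u \<in> e) - of_bool (v \<in> e)) * int (f e))"
    by (simp add: sum_subtractf left_diff_distrib)
  also have "\<dots> = (\<Sum>j=1..N. (of_bool (u \<in> g j) - of_bool (v \<in> g j)) * int (f (g j)))"
    by (rule sum.reindex_bij_betw[OF g, symmetric])
  \<comment> \<open>An edge containing both vertices or neither has coefficient 0 in either
    form.\<close>
  also have "\<dots> = (\<Sum>j=1..N. (of_bool (excl g u v j) - of_bool (excl g v u j)) * int (h j))"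
    by (rule sum.cong) (auto simp: f)
  finally show ?thesis .
qed

lemma card_excl:
  assumes V: "finite V" "card V = n" "u \<in> V" "v \<in> V" "u \<noteq> v"
    and g: "bij_betw g {1..N} (edges V)"
  shows "card {j \<in> {1..N}. excl g u v j} = n - 2"
proof -
  have "g ` {j \<in> {1..N}. excl g u v j} = D V u - D V v"
    unfolding D_def bij_betw_imp_surj_on[OF g, symmetric] by blast
  moreover have "inj_on g {j \<in> {1..N}. excl g u v j}"
    by (rule inj_on_subset[OF bij_betw_imp_inj_on[OF g]]) blast
  ultimately show ?thesis using card_D_Diff[OF V] by (metis card_image)
qed

section \<open>The two inequalities for \<open>R\<close>\<close>

theorem theorem4p3:
  fixes V :: "'a set" and t :: "'a set \<Rightarrow> nat" and n p :: nat and \<alpha> :: real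
  assumes "finite V" and "card V = n"
    and "n \<ge> 2" and "p \<ge> 1"
    and "edge_labeling V t"
    and "almost_supermagic V \<alpha> t"
  shows "(2 * real n - 4) * real p + \<alpha> \<ge> real_of_int (R V p t)
       \<and> real_of_int (R V p t) \<ge> (real n - 2 * real p - 19) * real p - \<alpha>"
proof
  note V = assms(1-3)
  have am: "\<bar>real_of_int (int (s V t u) - int (s V t v))\<bar> \<le> \<alpha>" if "u \<in> V" "v \<in> V" for u v
    using assms(6) that by (auto simp: almost_supermagic_def)
  let ?diffs = "\<lambda>f. {\<bar>int (s V f u) - int (s V f v)\<bar> | u v. u \<in> V \<and> v \<in> V \<and> u \<noteq> v}"
  have ne: "?diffs f \<noteq> {}" for f
  proof -
    obtain u v where "u \<in> V" "v \<in> V" "u \<noteq> v"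
      using V by (metis card_le_Suc0_iff_eq not_less_eq_eq numeral_2_eq_2)
    then show ?thesis by blast
  qed
  note R_fin = R_set_finite_nonempty[OF assms(1,5), of p]
  obtain \<theta> where \<theta>: "p_swap V p t \<theta>" "R V p t = max_diff V (\<theta> t)"
    using Max_in[OF R_fin] unfolding R_def by blast
  obtain u v where uv: "u \<in> V" "v \<in> V" "u \<noteq> v"
    "max_diff V (\<theta> t) = \<bar>int (s V (\<theta> t) u) - int (s V (\<theta> t) v)\<bar>"
    using Max_in[OF finite_max_diff_set[OF V(1)] ne, of "\<theta> t"] unfolding max_diff_def by blast
  have "R V p t \<le> \<bar>int (s V t u) - int (s V t v)\<bar> + (2 * int n - 4) * int p"
    unfolding \<theta>(2) uv(4) by (rule s_diff_swap_le[OF V uv(1-3) \<theta>(1)])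
  then have "real_of_int (R V p t) \<le>
      real_of_int (\<bar>int (s V t u) - int (s V t v)\<bar> + (2 * int n - 4) * int p)"
    by (simp only: of_int_le_iff)
  then show "real_of_int (R V p t) \<le> (2 * real n - 4) * real p + \<alpha>"
    using am[OF uv(1,2)] by simp
next
  note V = assms(1-3)
  define N where "N = n choose 2"
  \<comment> \<open>The edge carrying a given label.\<close>
  define g where "g = the_inv_into (edges V) t"
  have t: "bij_betw t (edges V) {1..N}"
    using assms(2,5) by (simp add: edge_labeling_def N_def)
  have g: "bij_betw g {1..N} (edges V)" unfolding g_def by (rule bij_betw_the_inv_into[OF t])
  have tg: "t (g j) = j" if "j \<in> {1..N}" for j
    unfolding g_def using t that by (intro f_the_inv_into_f_bij_betw) auto
  obtain u v where uv: "u \<in> V" "v \<in> V" "u \<noteq> v"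
    and l: "loss N p (excl g u v) (excl g v u) \<le> n + 2 * p + 15"
    using exists_pair_small_loss[OF V N_def assms(4) g] by blast
  obtain \<pi> :: "nat \<Rightarrow> nat" where \<pi>: "bij_betw \<pi> {1..N} {1..N}"
    "\<And>j. \<bar>int j - int (\<pi> j)\<bar> \<le> int p"
    and gain: "(\<Sum>j=1..N. (of_bool (excl g u v j) - of_bool (excl g v u j)) * int j) +
        int p * (int (card {j \<in> {1..N}. excl g u v j}) + int (card {j \<in> {1..N}. excl g v u j})
          - int (loss N p (excl g u v) (excl g v u)))
      \<le> (\<Sum>j=1..N. (of_bool (excl g u v j) - of_bool (excl g v u j)) * int (\<pi> j))"
    using two_colour_permutation[of "excl g u v" "excl g v u" N p] by blast
  let ?t' = "\<pi> \<circ> t"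
  have diff_t: "int (s V t u) - int (s V t v) =
      (\<Sum>j=1..N. (of_bool (excl g u v j) - of_bool (excl g v u j)) * int j)"
    by (rule s_diff_via_labels[OF V(1) g]) (rule tg)
  have diff_t': "int (s V ?t' u) - int (s V ?t' v) =
      (\<Sum>j=1..N. (of_bool (excl g u v j) - of_bool (excl g v u j)) * int (\<pi> j))"
    by (rule s_diff_via_labels[OF V(1) g]) (simp add: tg)
  \<comment> \<open>A constant map suffices, because \<open>p_swap\<close> constrains only the value
    at \<open>t\<close>; the label of \<open>e\<close> moves from \<open>t e\<close> to
    \<open>\<pi> (t e)\<close>.\<close>
  have swap: "p_swap V p t (\<lambda>_. ?t')"
    using bij_betw_trans[OF t \<pi>(1)] \<pi>(2) assms(2)
    by (simp add: p_swap_def edge_labeling_def N_def)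
  have "int (s V t u) - int (s V t v) + int p *
      (int (n - 2) + int (n - 2) - int (loss N p (excl g u v) (excl g v u)))
      \<le> int (s V ?t' u) - int (s V ?t' v)"
    using gain unfolding diff_t diff_t'
      card_excl[OF V(1,2) uv g] card_excl[OF V(1,2) uv(2,1) uv(3)[symmetric] g] .
  \<comment> \<open>\<open>2 (n - 2) - (n + 2 p + 15) = n - 2 p - 19\<close>, with
    \<open>n \<ge> 2\<close> making the truncated \<open>n - 2\<close> exact.\<close>
  moreover have "int p * (int n - 2 * int p - 19) \<le> int p *
      (int (n - 2) + int (n - 2) - int (loss N p (excl g u v) (excl g v u)))"
    using l V(3) by (intro mult_left_mono) (auto simp: of_nat_diff)
  moreover have "int (s V ?t' u) - int (s V ?t' v) \<le> max_diff V ?t'"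
    unfolding max_diff_def
    by (rule order.trans[OF abs_ge_self Max_ge[OF finite_max_diff_set[OF V(1)]]]) (use uv in blast)
  moreover have "max_diff V ?t' \<le> R V p t"
    unfolding R_def
    by (rule Max_ge[OF R_set_finite_nonempty(1)[OF assms(1,5)]]) (use swap in \<open>auto intro!: exI[of _ "\<lambda>_. ?t'"]\<close>)
  ultimately have "int (s V t u) - int (s V t v) + int p * (int n - 2 * int p - 19) \<le> R V p t"
    by linarith
  then have "real_of_int (int (s V t u) - int (s V t v) + int p * (int n - 2 * int p - 19))
      \<le> real_of_int (R V p t)"
    by (simp only: of_int_le_iff)
  \<comment> \<open>The initial signed difference may be negative, but it is at least
    \<open>- \<alpha>\<close>; this is the only cost of not controlling its sign.\<close>
  moreover have "\<bar>real (s V t u) - real (s V t v)\<bar> \<le> \<alpha>"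
    using assms(6) uv by (auto simp: almost_supermagic_def)
  ultimately show "(real n - 2 * real p - 19) * real p - \<alpha> \<le> real_of_int (R V p t)"
    by (simp add: mult.commute)
qed

end
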